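(* Let $P$ be a finite array TAOS, let $R(P)$ be the nilpotent Lie algebra obtained from $P$, and let $\langle\cdot,\cdot\rangle$ be the recursively constructed inner product on $R(P)$ described in the context. Let $x,y,z\in P$ satisfy $x\prec y\prec z$, and suppose there is no $t\in P$ such that $y\prec t\prec z$. Then $|(x,z)|=|(y,z)|$, where $|\cdot|$ is the norm of $\langle\cdot,\cdot\rangle$.
   Context: A transitively and antisymmetrically ordered set (TAOS) is a set $P$ with a binary relation $\prec$ that is transitive and antisymmetric ($s\prec t$, $t\prec s$ imply $s=t$). A chain is a subset in which any two distinct elements are comparable; its length is its cardinality. Lie algebra of a finite TAOS: $R(P)$ is the real vector space with basis $B(P)=\{(s,t)\mid s,t\in P,\ s\prec t\}\setminus\{(u,u)\mid u\in P,\ u\prec u\}$, with bilinear product determined by $(s,t)\cdot(u,v)=(s,v)$ if $t=u$ and $0$ if $t\ne u$, and Lie bracket $[x,y]=x\cdot y-y\cdot x$. Array TAOS: given integers $k\ge 2$, $n_1,\dots,n_k\ge 1$, and $m_1,\dots,m_k$ with $1\le m_i\le n_i$, $m_1=n_1$, $m_k=n_k$, let $P$ be a set with $\sum_{i=1}^k n_i$ elements partitioned into $k$ columns, the $i$-th column having $n_i$ elements. For each $i=1,\dots,k-1$ choose $m_{i+1}$ elements of the $(i+1)$-th column and declare $\eta_i\prec\eta_{i+1}$ for each element $\eta_i$ of the $i$-th column and each of the $m_{i+1}$ chosen elements $\eta_{i+1}$ of the $(i+1)$-th column. The relation $\prec$ on $P$ is the transitive closure of these relations. The maximal length of chains in $P$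 is $k$. The TAOS $\bar P$: let $r$ be the maximal length of chains in $P$, and let $x_{i1}\prec x_{i2}\prec\cdots\prec x_{ir}$ (over all $i$) be all chains of length $r$. Then $\bar P$ is the same set as $P$, with the same relation except that for every $i$ the elements $x_{i1}$ and $x_{i2}$ are made incomparable. Put $S=B(P)\setminus B(\bar P)$, the set of all $(x_{i1},x_{i2})$. If $P$ is an array TAOS with $r\ge 3$ and data $(n_1,\dots,n_r)$, $(m_1,\dots,m_r)$, then $\bar P$ is again an array TAOS, with maximal chain length $r-1$ and data $(n_1+n_2,n_3,\dots,n_r)$, $(n_1+n_2,m_3,\dots,m_r)$. The inner product on $R(P)$ for an array TAOS $P$ is defined recursively on the maximal chain length $r$: if $r=2$, it is the inner product making $B(P)$ orthonormal; if $r\ge 3$, it is the inner product for which $B(P)$ is orthogonal, whose restriction to the subspace $R(\bar P)\subset R(P)$ is the inner product already constructed for $\bar P$, and for which every $(x_{i1},x_{i2})\in S$ satisfies $\langle (x_{i1},x_{i2}),(x_{i1},x_{i2})\rangle=\frac12\sum_{t=1}^r m_t$. *)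

theory Defs
  imports Complex_Main "HOL-Library.Disjoint_Sets"
begin

section \<open>Transitively and antisymmetrically ordered sets\<close>

definition taos :: "'a set \<Rightarrow> 'a rel \<Rightarrow> bool" where
  "taos P prec \<longleftrightarrow> prec \<subseteq> P \<times> P \<and> trans prec \<and> antisym prec"

definition chain_in :: "'a set \<Rightarrow> 'a rel \<Rightarrow> 'a set \<Rightarrow> bool" where
  "chain_in P prec X \<longleftrightarrow>
     X \<subseteq> P \<and> (\<forall>a\<in>X. \<forall>b\<in>X. a \<noteq> b \<longrightarrow> (a, b) \<in> prec \<or> (b, a) \<in> prec)"

definition max_chain_length :: "'a set \<Rightarrow> 'a rel \<Rightarrow> nat" where
  "max_chain_length P prec = Max (card ` {X. chain_in P prec X})"

text \<open>The chains of maximal length \<open>r\<close>, listed increasingly as \<open>[x\<^sub>1, \<dots>, x\<^sub>r]\<close>.  Distinctness is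
  demanded separately because \<open>prec\<close> need not be irreflexive.\<close>

definition longest_chains :: "'a set \<Rightarrow> 'a rel \<Rightarrow> 'a list set" where
  "longest_chains P prec =
     {xs. set xs \<subseteq> P \<and> distinct xs \<and> length xs = max_chain_length P prec \<and>
          sorted_wrt (\<lambda>a b. (a, b) \<in> prec) xs}"

section \<open>The Lie algebra of a finite TAOS\<close>

text \<open>An element of the real vector space with basis \<open>B\<close> is represented by its coefficient function,
  which vanishes outside \<open>B\<close>; the vector space operations are the pointwise ones.\<close>

definition basis_pairs :: "'a set \<Rightarrow> 'a rel \<Rightarrow> ('a \<times> 'a) set" where
  "basis_pairs P prec = {(s, t). s \<in> P \<and> t \<in> P \<and> (s, t) \<in> prec} - {(u, u) | u. u \<in> P \<and> (u, u) \<in> prec}"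

definition basis_vec :: "'b \<Rightarrow> 'b \<Rightarrow> real" where
  "basis_vec b = (\<lambda>c. if c = b then 1 else 0)"

fun basis_mult :: "'a \<times> 'a \<Rightarrow> 'a \<times> 'a \<Rightarrow> 'a \<times> 'a \<Rightarrow> real" where
  "basis_mult (s, t) (u, v) = (if t = u then basis_vec (s, v) else (\<lambda>_. 0))"

text \<open>For \<open>p, q\<close> in the basis with \<open>basis_mult p q \<noteq> 0\<close>, transitivity and antisymmetry put the
  resulting pair in the basis again.\<close>

definition taos_mult ::
    "'a set \<Rightarrow> 'a rel \<Rightarrow> ('a \<times> 'a \<Rightarrow> real) \<Rightarrow> ('a \<times> 'a \<Rightarrow> real) \<Rightarrow> ('a \<times> 'a \<Rightarrow> real)" where
  "taos_mult P prec v w =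
     (\<lambda>c. \<Sum>p\<in>basis_pairs P prec. \<Sum>q\<in>basis_pairs P prec. v p * w q * basis_mult p q c)"

record 'v bracket_algebra =
  alg_carrier :: "'v set"
  alg_bracket :: "'v \<Rightarrow> 'v \<Rightarrow> 'v"

definition taos_lie_algebra :: "'a set \<Rightarrow> 'a rel \<Rightarrow> ('a \<times> 'a \<Rightarrow> real) bracket_algebra" where
  "taos_lie_algebra P prec =
     \<lparr> alg_carrier = {v. \<forall>b. b \<notin> basis_pairs P prec \<longrightarrow> v b = 0},
       alg_bracket = (\<lambda>v w c. taos_mult P prec v w c - taos_mult P prec w v c) \<rparr>"

section \<open>Array TAOS\<close>

text \<open>\<open>C i\<close> is the \<open>i\<close>-th column and \<open>D i\<close> the set of its chosen elements; there is no choice in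
  the first column, so \<open>D 1\<close> is irrelevant.\<close>

definition array_base :: "nat \<Rightarrow> (nat \<Rightarrow> 'a set) \<Rightarrow> (nat \<Rightarrow> 'a set) \<Rightarrow> 'a rel" where
  "array_base k C D = {(a, b). \<exists>i\<in>{1..<k}. a \<in> C i \<and> b \<in> D (Suc i)}"

definition array_columns ::
    "'a set \<Rightarrow> nat \<Rightarrow> (nat \<Rightarrow> nat) \<Rightarrow> (nat \<Rightarrow> nat) \<Rightarrow> (nat \<Rightarrow> 'a set) \<Rightarrow> (nat \<Rightarrow> 'a set) \<Rightarrow> bool" where
  "array_columns P k n m C D \<longleftrightarrow>
     2 \<le> k \<and> (\<forall>i\<in>{1..k}. 1 \<le> n i \<and> 1 \<le> m i \<and> m i \<le> n i) \<and> m 1 = n 1 \<and> m k = n k \<and>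
     P = (\<Union>i\<in>{1..k}. C i) \<and> disjoint_family_on C {1..k} \<and>
     (\<forall>i\<in>{1..k}. finite (C i) \<and> card (C i) = n i) \<and>
     (\<forall>i\<in>{2..k}. D i \<subseteq> C i \<and> card (D i) = m i)"

definition array_taos_data ::
    "'a set \<Rightarrow> 'a rel \<Rightarrow> nat \<Rightarrow> (nat \<Rightarrow> nat) \<Rightarrow> (nat \<Rightarrow> nat) \<Rightarrow> bool" where
  "array_taos_data P prec k n m \<longleftrightarrow>
     (\<exists>C D. array_columns P k n m C D \<and> prec = (array_base k C D)\<^sup>+)"

definition array_taos :: "'a set \<Rightarrow> 'a rel \<Rightarrow> bool" where
  "array_taos P prec \<longleftrightarrow> (\<exists>k n m. array_taos_data P prec k n m)"

section \<open>The inner product\<close>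

definition bar :: "'a set \<Rightarrow> 'a rel \<Rightarrow> 'a rel" where
  "bar P prec = {(a, b) \<in> prec. \<not> (\<exists>xs\<in>longest_chains P prec. {a, b} = {xs ! 0, xs ! 1})}"

definition removed_pairs :: "'a set \<Rightarrow> 'a rel \<Rightarrow> ('a \<times> 'a) set" where
  "removed_pairs P prec = basis_pairs P prec - basis_pairs P (bar P prec)"

definition inner_product_on ::
    "('b \<Rightarrow> real) set \<Rightarrow> (('b \<Rightarrow> real) \<Rightarrow> ('b \<Rightarrow> real) \<Rightarrow> real) \<Rightarrow> bool" where
  "inner_product_on V ip \<longleftrightarrow>
     (\<forall>v\<in>V. \<forall>w\<in>V. ip v w = ip w v) \<and>
     (\<forall>u\<in>V. \<forall>v\<in>V. \<forall>w\<in>V. ip (\<lambda>c. u c + v c) w = ip u w + ip v w) \<and>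
     (\<forall>a. \<forall>v\<in>V. \<forall>w\<in>V. ip (\<lambda>c. a * v c) w = a * ip v w) \<and>
     (\<forall>v\<in>V. v \<noteq> (\<lambda>_. 0) \<longrightarrow> 0 < ip v v)"

definition ip_norm :: "(('b \<Rightarrow> real) \<Rightarrow> ('b \<Rightarrow> real) \<Rightarrow> real) \<Rightarrow> ('b \<Rightarrow> real) \<Rightarrow> real" where
  "ip_norm ip v = sqrt (ip v v)"

text \<open>\<open>array_inner_product P ip prec\<close> says that \<open>ip\<close>, restricted to the vectors of
  \<open>taos_lie_algebra P prec\<close>, is the recursively constructed inner product; nothing is said about the
  values of \<open>ip\<close> on other functions.  Since \<open>taos_lie_algebra P (bar P prec)\<close> is a subspace with
  the same representation of vectors, the condition on the restriction to it is expressed by the same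
  predicate for the same \<open>ip\<close>.\<close>

inductive array_inner_product ::
    "'a set \<Rightarrow> (('a \<times> 'a \<Rightarrow> real) \<Rightarrow> ('a \<times> 'a \<Rightarrow> real) \<Rightarrow> real) \<Rightarrow> 'a rel \<Rightarrow> bool"
  for P :: "'a set" and ip :: "('a \<times> 'a \<Rightarrow> real) \<Rightarrow> ('a \<times> 'a \<Rightarrow> real) \<Rightarrow> real" where
  two: "array_inner_product P ip prec"
    if "array_taos P prec" and "max_chain_length P prec = 2"
      and "inner_product_on (alg_carrier (taos_lie_algebra P prec)) ip"
      and "\<forall>b\<in>basis_pairs P prec. \<forall>c\<in>basis_pairs P prec.
             ip (basis_vec b) (basis_vec c) = (if b = c then 1 else 0)"
| step: "array_inner_product P ip prec"
    if "array_taos_data P prec r n m" and "max_chain_length P prec = r" and "3 \<le> r"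
      and "inner_product_on (alg_carrier (taos_lie_algebra P prec)) ip"
      and "\<forall>b\<in>basis_pairs P prec. \<forall>c\<in>basis_pairs P prec.
             b \<noteq> c \<longrightarrow> ip (basis_vec b) (basis_vec c) = 0"
      and "array_inner_product P ip (bar P prec)"
      and "\<forall>b\<in>removed_pairs P prec.
             ip (basis_vec b) (basis_vec b) = 1 / 2 * (\<Sum>t = 1..r. real (m t))"

section \<open>Consistency of the construction\<close>

lemma array_columns_mem:
  assumes "array_columns P k n m C D"
  shows "i \<in> {1..k} \<Longrightarrow> C i \<noteq> {}" "i \<in> {2..k} \<Longrightarrow> D i \<noteq> {}"
    "i \<in> {2..k} \<Longrightarrow> b \<in> D i \<Longrightarrow> b \<in> C i"
    "i \<in> {1..k} \<Longrightarrow> j \<in> {1..k} \<Longrightarrow> a \<in> C i \<Longrightarrow> a \<in> C j \<Longrightarrow> i = j"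
    "a \<in> P \<longleftrightarrow> (\<exists>i\<in>{1..k}. a \<in> C i)"
    "finite P"
proof -
  note A = assms[unfolded array_columns_def]
  show "C i \<noteq> {}" if "i \<in> {1..k}"
    using A that by (metis card.empty not_one_le_zero)
  show "D i \<noteq> {}" if "i \<in> {2..k}"
  proof -
    have "i \<in> {1..k}" using that by auto
    then have "1 \<le> m i" "card (D i) = m i" using A that by auto
    then show ?thesis by auto
  qed
  show "b \<in> C i" if "i \<in> {2..k}" "b \<in> D i" using A that by blast
  show "i = j" if "i \<in> {1..k}" "j \<in> {1..k}" "a \<in> C i" "a \<in> C j"
    using A that unfolding disjoint_family_on_def by (metis disjoint_iff)
  show "a \<in> P \<longleftrightarrow> (\<exists>i\<in>{1..k}. a \<in> C i)" using A by auto
  show "finite P" using A by auto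
qed

lemma array_rel_iff:
  assumes "array_columns P k n m C D"
  shows "(a, b) \<in> (array_base k C D)\<^sup>+ \<longleftrightarrow> (\<exists>i j. 1 \<le> i \<and> i < j \<and> j \<le> k \<and> a \<in> C i \<and> b \<in> D j)"
proof
  assume "(a, b) \<in> (array_base k C D)\<^sup>+"
  then show "\<exists>i j. 1 \<le> i \<and> i < j \<and> j \<le> k \<and> a \<in> C i \<and> b \<in> D j"
  proof (induction rule: trancl_induct)
    case (base b)
    then obtain i where "i \<in> {1..<k}" "a \<in> C i" "b \<in> D (Suc i)"
      unfolding array_base_def by auto
    then show ?case by (intro exI[of _ i] exI[of _ "Suc i"]) auto
  next
    case (step b c)
    from step.IH obtain i j where ij: "1 \<le> i" "i < j" "j \<le> k" "a \<in> C i" "b \<in> D j" by auto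
    from step.hyps(2) obtain l where l: "l \<in> {1..<k}" "b \<in> C l" "c \<in> D (Suc l)"
      unfolding array_base_def by auto
    have "b \<in> C j" using array_columns_mem(3)[OF assms, of j b] ij by auto
    then have "j = l" using array_columns_mem(4)[OF assms, of j l b] ij l by auto
    then show ?case using ij l by (intro exI[of _ i] exI[of _ "Suc l"]) auto
  qed
next
  assume "\<exists>i j. 1 \<le> i \<and> i < j \<and> j \<le> k \<and> a \<in> C i \<and> b \<in> D j"
  then obtain i j where ij: "1 \<le> i" "i < j" "j \<le> k" "a \<in> C i" "b \<in> D j" by auto
  from ij(2) have "Suc i \<le> j" by simp
  then have "j \<le> k \<Longrightarrow> b \<in> D j \<Longrightarrow> (a, b) \<in> (array_base k C D)\<^sup>+" for b
  proof (induction j arbitrary: b rule: dec_induct)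
    case base
    then have "(a, b) \<in> array_base k C D" using ij(1,4) unfolding array_base_def by auto
    then show ?case by auto
  next
    case (step l)
    obtain d where d: "d \<in> D l" using array_columns_mem(2)[OF assms, of l] step ij(1) by auto
    have "d \<in> C l" using array_columns_mem(3)[OF assms, of l d] step ij(1) d by auto
    then have "(d, b) \<in> array_base k C D" using step unfolding array_base_def by auto
    moreover have "(a, d) \<in> (array_base k C D)\<^sup>+" using step d by auto
    ultimately show ?case by (meson trancl.trancl_into_trancl)
  qed
  then show "(a, b) \<in> (array_base k C D)\<^sup>+" using ij by auto
qed

lemma array_taos_imp_taos:
  assumes "array_taos P prec"
  shows "taos P prec" "finite P" "irrefl prec"
proof -
  obtain k n m C D where A: "array_columns P k n m C D" and prec: "prec = (array_base k C D)\<^sup>+"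
    using assms unfolding array_taos_def array_taos_data_def by auto
  note rel = array_rel_iff[OF A, folded prec]
  show "finite P" using array_columns_mem(6)[OF A] .
  have tr: "trans prec" unfolding prec by simp
  show irr: "irrefl prec"
  proof (rule irreflI)
    fix a show "(a, a) \<notin> prec"
    proof
      assume "(a, a) \<in> prec"
      then obtain i j where ij: "1 \<le> i" "i < j" "j \<le> k" "a \<in> C i" "a \<in> D j" using rel by auto
      then have "a \<in> C j" using array_columns_mem(3)[OF A, of j a] by auto
      then show False using array_columns_mem(4)[OF A, of i j a] ij by auto
    qed
  qed
  have "prec \<subseteq> P \<times> P"
  proof clarify
    fix a b assume "(a, b) \<in> prec"
    then obtain i j where ij: "1 \<le> i" "i < j" "j \<le> k" "a \<in> C i" "b \<in> D j" using rel by auto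
    then have "b \<in> C j" using array_columns_mem(3)[OF A, of j b] by auto
    then show "a \<in> P \<and> b \<in> P" using ij array_columns_mem(5)[OF A]
      by (meson atLeastAtMost_iff less_le_not_le order.trans)
  qed
  then show "taos P prec" using tr irr unfolding taos_def
    by (meson antisymI irrefl_def transD)
qed

lemma array_max_chain_length:
  assumes "array_taos_data P prec k n m"
  shows "max_chain_length P prec = k"
proof -
  obtain C D where A: "array_columns P k n m C D" and prec: "prec = (array_base k C D)\<^sup>+"
    using assms unfolding array_taos_data_def by auto
  note rel = array_rel_iff[OF A, folded prec]
  have k: "2 \<le> k" using A unfolding array_columns_def by auto
  have at: "array_taos P prec" using assms unfolding array_taos_def by auto
  define col where "col a = (SOME i. i \<in> {1..k} \<and> a \<in> C i)" for a
  have col: "col a \<in> {1..k}" "a \<in> C (col a)" if "a \<in> P" for a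
  proof -
    have "\<exists>i. i \<in> {1..k} \<and> a \<in> C i" using that array_columns_mem(5)[OF A, of a] by blast
    from someI_ex[OF this] show "col a \<in> {1..k}" "a \<in> C (col a)" unfolding col_def by blast+
  qed
  have col_less: "col a \<noteq> col b" if "(a, b) \<in> prec" for a b
  proof -
    from rel[THEN iffD1, OF that]
    obtain i j where ij: "1 \<le> i" "i < j" "j \<le> k" "a \<in> C i" "b \<in> D j" by blast
    have bj: "b \<in> C j" using array_columns_mem(3)[OF A, of j b] ij by auto
    have "a \<in> P" "b \<in> P" using array_taos_imp_taos(1)[OF at] that unfolding taos_def by auto
    then have "col a = i" "col b = j"
      using col[of a] col[of b] array_columns_mem(4)[OF A, of "col a" i a]
        array_columns_mem(4)[OF A, of "col b" j b] ij bj by simp_all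
    then show ?thesis using ij by auto
  qed
  have le: "card X \<le> k" if "chain_in P prec X" for X
  proof -
    have "inj_on col X" using that col_less unfolding chain_in_def inj_on_def by metis
    moreover have "col ` X \<subseteq> {1..k}" using that col unfolding chain_in_def by auto
    ultimately have "card X \<le> card {1..k}" using card_inj_on_le by blast
    then show ?thesis by simp
  qed
  define f where "f i = (SOME a. a \<in> C i \<and> (2 \<le> i \<longrightarrow> a \<in> D i))" for i
  have f: "f i \<in> C i \<and> (2 \<le> i \<longrightarrow> f i \<in> D i)" if "i \<in> {1..k}" for i
    unfolding f_def
  proof (rule someI_ex)
    show "\<exists>a. a \<in> C i \<and> (2 \<le> i \<longrightarrow> a \<in> D i)"
    proof (cases "2 \<le> i")
      case True
      then have i: "i \<in> {2..k}" using that by simp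
      then obtain a where "a \<in> D i" using array_columns_mem(2)[OF A i] by auto
      then show ?thesis using array_columns_mem(3)[OF A i] by blast
    next
      case False
      then show ?thesis using array_columns_mem(1)[OF A that] by auto
    qed
  qed
  have prec_f: "(f i, f j) \<in> prec" if "1 \<le> i" "i < j" "j \<le> k" for i j
  proof -
    have "f i \<in> C i" "f j \<in> D j" using f[of i] f[of j] that by auto
    then show ?thesis using rel that by blast
  qed
  have inj: "inj_on f {1..k}"
    using f array_columns_mem(4)[OF A] unfolding inj_on_def by metis
  have ch: "chain_in P prec (f ` {1..k})"
    unfolding chain_in_def
  proof (intro conjI ballI impI)
    show "f ` {1..k} \<subseteq> P" using f array_columns_mem(5)[OF A] by blast
    fix a b assume "a \<in> f ` {1..k}" "b \<in> f ` {1..k}" "a \<noteq> b"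
    then obtain i j where "i \<in> {1..k}" "j \<in> {1..k}" "a = f i" "b = f j" "i \<noteq> j" by blast
    then show "(a, b) \<in> prec \<or> (b, a) \<in> prec" using prec_f[of i j] prec_f[of j i]
      by (cases "i < j") auto
  qed
  have "card (f ` {1..k}) = k" using card_image[OF inj] by simp
  then have "k \<in> card ` {X. chain_in P prec X}" using ch by (metis imageI mem_Collect_eq)
  moreover have "finite (card ` {X. chain_in P prec X})"
    by (rule finite_subset[of _ "{..k}"]) (use le in auto)
  ultimately show ?thesis unfolding max_chain_length_def
    by (intro Max_eqI) (use le in auto)
qed

lemma array_bar_eq:
  assumes A: "array_columns P k n m C D" and prec: "prec = (array_base k C D)\<^sup>+"
  shows "bar P prec = prec - C 1 \<times> D 2"
proof -
  note rel = array_rel_iff[OF A, folded prec]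
  have k: "2 \<le> k" using A unfolding array_columns_def by auto
  have dat: "array_taos_data P prec k n m" using A prec unfolding array_taos_data_def by auto
  then have at: "array_taos P prec" unfolding array_taos_def by auto
  have len: "max_chain_length P prec = k" using array_max_chain_length[OF dat] .
  have head: "xs ! 0 \<in> C 1 \<and> xs ! 1 \<in> D 2" if xs: "xs \<in> longest_chains P prec" for xs
  proof -
    have X: "set xs \<subseteq> P" "length xs = k" "sorted_wrt (\<lambda>a b. (a, b) \<in> prec) xs"
      using xs len unfolding longest_chains_def by auto
    have low: "\<exists>i. Suc l \<le> i \<and> i \<le> k \<and> xs ! l \<in> C i" if "l < k" for l
      using that
    proof (induction l)
      case 0
      then have "xs ! 0 \<in> P" using X by (metis nth_mem subsetD)
      then show ?case using array_columns_mem(5)[OF A] by fastforce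
    next
      case (Suc l)
      then obtain i where i: "Suc l \<le> i" "i \<le> k" "xs ! l \<in> C i" by auto
      have "(xs ! l, xs ! Suc l) \<in> prec" using X Suc sorted_wrt_nth_less by fastforce
      then obtain i' j where ij: "1 \<le> i'" "i' < j" "j \<le> k" "xs ! l \<in> C i'" "xs ! Suc l \<in> D j"
        using rel by auto
      have "i = i'" using array_columns_mem(4)[OF A, of i i' "xs ! l"] i ij by auto
      then have "Suc (Suc l) \<le> j" "j \<le> k" "xs ! Suc l \<in> C j"
        using ij i array_columns_mem(3)[OF A, of j "xs ! Suc l"] by auto
      then show ?case by blast
    qed
    have high: "\<exists>i. 1 \<le> i \<and> i + l \<le> k \<and> xs ! (k - 1 - l) \<in> C i" if "l < k" for l
      using that
    proof (induction l)
      case 0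
      then obtain i where "k \<le> i" "i \<le> k" "xs ! (k - 1) \<in> C i" using low[of "k - 1"] by auto
      then show ?case using 0 by (intro exI[of _ i]) auto
    next
      case (Suc l)
      then obtain i where i: "1 \<le> i" "i + l \<le> k" "xs ! (k - 1 - l) \<in> C i" by auto
      have "(xs ! (k - 1 - Suc l), xs ! (k - 1 - l)) \<in> prec"
        using sorted_wrt_nth_less[OF X(3), of "k - 1 - Suc l" "k - 1 - l"] X(2) Suc.prems by linarith
      from rel[THEN iffD1, OF this] obtain i' j where ij: "1 \<le> i'" "i' < j" "j \<le> k"
          "xs ! (k - 1 - Suc l) \<in> C i'" "xs ! (k - 1 - l) \<in> D j"
        by blast
      have "xs ! (k - 1 - l) \<in> C j" using array_columns_mem(3)[OF A, of j] ij by auto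
      then have "i = j" using array_columns_mem(4)[OF A, of i j] i ij by auto
      then show ?case using ij i by (intro exI[of _ i']) auto
    qed
    have "\<exists>i. 1 \<le> i \<and> i + (k - 2) \<le> k \<and> xs ! (k - 1 - (k - 2)) \<in> C i" using high[of "k - 2"] k by simp
    moreover have "k - 1 - (k - 2) = 1" using k by simp
    ultimately obtain i where i: "1 \<le> i" "i \<le> 2" "xs ! 1 \<in> C i" using k by auto
    have "(xs ! 0, xs ! 1) \<in> prec" using sorted_wrt_nth_less[OF X(3), of 0 1] X(2) k by simp
    from rel[THEN iffD1, OF this] obtain i' j where ij: "1 \<le> i'" "i' < j" "j \<le> k"
        "xs ! 0 \<in> C i'" "xs ! 1 \<in> D j"
      by blast
    have "xs ! 1 \<in> C j" using array_columns_mem(3)[OF A, of j] ij by auto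
    then have "i = j" using array_columns_mem(4)[OF A, of i j] i ij k by auto
    then have "i' = 1" "j = 2" using ij i by auto
    then show ?thesis using ij(4,5) by simp
  qed
  have ex: "\<exists>xs\<in>longest_chains P prec. xs ! 0 = a \<and> xs ! 1 = b" if ab: "a \<in> C 1" "b \<in> D 2" for a b
  proof -
    define f where "f i = (if i = 1 then a else if i = 2 then b else (SOME c. c \<in> D i))" for i
    have fD: "f i \<in> D i" if "i \<in> {2..k}" for i
      using array_columns_mem(2)[OF A that] ab that unfolding f_def by (auto simp: some_in_eq)
    have fC: "f i \<in> C i" if "i \<in> {1..k}" for i
      using array_columns_mem(3)[OF A, of i "f i"] fD[of i] ab that
      by (cases "i = 1") (auto simp: f_def)
    define xs where "xs = map f [1..<Suc k]"
    have "sorted_wrt (\<lambda>a b. (a, b) \<in> prec) xs"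
      unfolding sorted_wrt_iff_nth_less
    proof (intro allI impI)
      fix i j assume ij: "i < j" "j < length xs"
      then have "xs ! i = f (Suc i)" "xs ! j = f (Suc j)" unfolding xs_def by (auto simp del: upt_Suc)
      moreover have "f (Suc i) \<in> C (Suc i)" "f (Suc j) \<in> D (Suc j)"
        using ij fC[of "Suc i"] fD[of "Suc j"] unfolding xs_def by (auto simp del: upt_Suc)
      ultimately show "(xs ! i, xs ! j) \<in> prec" using ij unfolding xs_def
        by (intro iffD2[OF rel] exI[of _ "Suc i"] exI[of _ "Suc j"]) (auto simp del: upt_Suc)
    qed
    moreover have "inj_on f {1..k}"
      using fC array_columns_mem(4)[OF A] unfolding inj_on_def by metis
    then have "distinct xs" unfolding xs_def by (simp add: distinct_map atLeastLessThanSuc_atLeastAtMost del: upt_Suc)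
    moreover have "set xs \<subseteq> P" using fC array_columns_mem(5)[OF A]
      unfolding xs_def by (fastforce simp del: upt_Suc)
    moreover have "length xs = k" unfolding xs_def by simp
    ultimately have "xs \<in> longest_chains P prec" using len unfolding longest_chains_def by auto
    moreover have "xs ! 0 = a" "xs ! 1 = b" using k unfolding xs_def f_def
      by (auto simp del: upt_Suc)
    ultimately show ?thesis by blast
  qed
  have irr: "(b, a) \<notin> prec" if "a \<in> C 1" "b \<in> D 2" for a b
  proof
    assume "(b, a) \<in> prec"
    then obtain i j where ij: "1 \<le> i" "i < j" "j \<le> k" "b \<in> C i" "a \<in> D j" using rel by auto
    then have "a \<in> C j" using array_columns_mem(3)[OF A, of j a] by auto
    then show False using array_columns_mem(4)[OF A, of j 1 a] ij that by auto
  qed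
  have "(a, b) \<in> bar P prec \<longleftrightarrow> (a, b) \<in> prec - C 1 \<times> D 2" for a b
  proof
    assume H: "(a, b) \<in> bar P prec"
    then have "(a, b) \<in> prec" unfolding bar_def by auto
    moreover have "\<not> (a \<in> C 1 \<and> b \<in> D 2)"
      using ex[of a b] H unfolding bar_def by auto
    ultimately show "(a, b) \<in> prec - C 1 \<times> D 2" by auto
  next
    assume "(a, b) \<in> prec - C 1 \<times> D 2"
    then have p: "(a, b) \<in> prec" and no: "(a, b) \<notin> C 1 \<times> D 2" by auto
    have "{a, b} \<noteq> {xs ! 0, xs ! 1}" if "xs \<in> longest_chains P prec" for xs
      using head[OF that] irr[of "xs ! 0" "xs ! 1"] p no by (metis SigmaI doubleton_eq_iff)
    then show "(a, b) \<in> bar P prec" using p unfolding bar_def by blast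
  qed
  then show ?thesis by (metis subrelI subset_antisym)
qed

text \<open>The data of \<open>bar P prec\<close>, with the indexing shifted by the merged first column.\<close>

lemma array_bar_data:
  assumes dat: "array_taos_data P prec k n m" and k3: "3 \<le> k"
  shows "array_taos_data P (bar P prec) (k - 1)
           (\<lambda>i. if i = 1 then n 1 + n 2 else n (Suc i)) (\<lambda>i. if i = 1 then n 1 + n 2 else m (Suc i))"
    (is "array_taos_data _ _ _ ?n ?m")
proof -
  obtain C D where A: "array_columns P k n m C D" and prec: "prec = (array_base k C D)\<^sup>+"
    using dat unfolding array_taos_data_def by auto
  note rel = array_rel_iff[OF A, folded prec]
  note U = A[unfolded array_columns_def]
  define C' where "C' i = (if i = 1 then C 1 \<union> C 2 else C (Suc i))" for i :: nat
  define D' where "D' i = D (Suc i)" for i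
  have un: "P = (\<Union>i\<in>{1..k - 1}. C' i)"
  proof (intro set_eqI iffI)
    fix a assume "a \<in> P"
    then obtain i where i: "i \<in> {1..k}" "a \<in> C i" using array_columns_mem(5)[OF A] by auto
    show "a \<in> (\<Union>i\<in>{1..k - 1}. C' i)"
    proof (cases "i \<le> 2")
      case True
      then have "i = 1 \<or> i = 2" using i by auto
      then have "a \<in> C' 1" using i unfolding C'_def by auto
      then show ?thesis using k3 by (intro UN_I[of 1]) auto
    next
      case False
      then have "a \<in> C' (i - 1)" using i unfolding C'_def by auto
      then show ?thesis using i False by (intro UN_I[of "i - 1"]) auto
    qed
  next
    fix a assume "a \<in> (\<Union>i\<in>{1..k - 1}. C' i)"
    then obtain i where i: "i \<in> {1..k - 1}" "a \<in> C' i" by auto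
    have "\<exists>j\<in>{1..k}. a \<in> C j"
    proof (cases "i = 1")
      case True then show ?thesis using i k3 unfolding C'_def
        by (metis Un_iff atLeastAtMost_iff le_trans one_le_numeral numeral_le_iff semiring_norm(69,72) order_refl eval_nat_numeral(3) Suc_leD)
    next
      case False then show ?thesis using i unfolding C'_def by (intro bexI[of _ "Suc i"]) auto
    qed
    then show "a \<in> P" using array_columns_mem(5)[OF A] by auto
  qed
  have dj: "disjoint_family_on C' {1..k - 1}"
    unfolding disjoint_family_on_def
  proof (intro ballI impI)
    fix i j assume ij: "i \<in> {1..k - 1}" "j \<in> {1..k - 1}" "i \<noteq> j"
    have D: "C p \<inter> C q = {}" if "p \<in> {1..k}" "q \<in> {1..k}" "p \<noteq> q" for p q
      using array_columns_mem(4)[OF A, of p q] that by auto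
    show "C' i \<inter> C' j = {}"
    proof -
      have s: "1 \<in> {1..k}" "2 \<in> {1..k}" "Suc i \<in> {1..k}" "Suc j \<in> {1..k}" using ij k3 by auto
      consider "i = 1" "2 < Suc j" | "j = 1" "2 < Suc i" | "i \<noteq> 1" "j \<noteq> 1" using ij by force
      then show ?thesis
      proof cases
        case 1
        then show ?thesis using D[of 1 "Suc j"] D[of 2 "Suc j"] s unfolding C'_def by auto
      next
        case 2
        then show ?thesis using D[of "Suc i" 1] D[of "Suc i" 2] s unfolding C'_def by auto
      next
        case 3
        then show ?thesis using D[of "Suc i" "Suc j"] s ij unfolding C'_def by auto
      qed
    qed
  qed
  have A': "array_columns P (k - 1) ?n ?m C' D'"
    unfolding array_columns_def
  proof (intro conjI ballI)
    show "2 \<le> k - 1" using k3 by simp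
    show "?m 1 = ?n 1" by simp
    show "?m (k - 1) = ?n (k - 1)" using U k3 by auto
    show "P = (\<Union>i\<in>{1..k - 1}. C' i)" by (rule un)
    show "disjoint_family_on C' {1..k - 1}" by (rule dj)
  next
    fix i assume i: "i \<in> {1..k - 1}"
    have cb: "1 \<le> n p" "1 \<le> m p" "m p \<le> n p" "finite (C p)" "card (C p) = n p" if "p \<in> {1..k}" for p
      using U that by auto
    note c1 = cb[of 1] and c2 = cb[of 2] and cs = cb[of "Suc i"]
    have s: "1 \<in> {1..k}" "2 \<in> {1..k}" "Suc i \<in> {1..k}" using i k3 by auto
    show "1 \<le> ?n i" "1 \<le> ?m i" "?m i \<le> ?n i" using c1 cs s by auto
    show "finite (C' i)" using c1 c2 cs s unfolding C'_def by auto
    have "C 1 \<inter> C 2 = {}" using array_columns_mem(4)[OF A, of 1 2] s by auto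
    then show "card (C' i) = ?n i" using c1 c2 cs s unfolding C'_def by (auto simp: card_Un_disjoint)
  next
    fix i assume i: "i \<in> {2..k - 1}"
    then have "Suc i \<in> {2..k}" by auto
    then show "D' i \<subseteq> C' i" "card (D' i) = ?m i" using U i unfolding D'_def C'_def by auto
  qed
  have "bar P prec = (array_base (k - 1) C' D')\<^sup>+"
  proof -
    have "(a, b) \<in> bar P prec \<longleftrightarrow> (a, b) \<in> (array_base (k - 1) C' D')\<^sup>+" for a b
    proof
      assume "(a, b) \<in> bar P prec"
      then have "(a, b) \<in> prec" and no: "\<not> (a \<in> C 1 \<and> b \<in> D 2)"
        unfolding array_bar_eq[OF A prec] by auto
      then obtain i j where ij: "1 \<le> i" "i < j" "j \<le> k" "a \<in> C i" "b \<in> D j" using rel by auto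
      have j: "3 \<le> j"
      proof (rule ccontr)
        assume "\<not> 3 \<le> j"
        then have "i = 1" "j = 2" using ij by auto
        then show False using ij(4,5) no by simp
      qed
      have bD: "b \<in> D' (j - 1)" using ij j unfolding D'_def by auto
      show "(a, b) \<in> (array_base (k - 1) C' D')\<^sup>+"
      proof (cases "i \<le> 2")
        case True
        then have "i = 1 \<or> i = 2" using ij by auto
        then have "a \<in> C' 1" using ij unfolding C'_def by auto
        then show ?thesis unfolding array_rel_iff[OF A']
          using ij j bD by (intro exI[of _ 1] exI[of _ "j - 1"]) auto
      next
        case False
        then have "a \<in> C' (i - 1)" using ij unfolding C'_def by auto
        then show ?thesis unfolding array_rel_iff[OF A']
          using ij j bD False by (intro exI[of _ "i - 1"] exI[of _ "j - 1"]) auto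
      qed
    next
      assume "(a, b) \<in> (array_base (k - 1) C' D')\<^sup>+"
      then obtain i j where ij: "1 \<le> i" "i < j" "j \<le> k - 1" "a \<in> C' i" "b \<in> D' j"
        unfolding array_rel_iff[OF A'] by auto
      obtain p where p: "1 \<le> p" "p \<le> Suc i" "a \<in> C p"
      proof (cases "i = 1")
        case True
        then have "a \<in> C 1 \<or> a \<in> C 2" using ij unfolding C'_def by auto
        then show ?thesis using that[of 1] that[of 2] True by auto
      next
        case False
        then show ?thesis using that[of "Suc i"] ij unfolding C'_def by auto
      qed
      have b: "b \<in> D (Suc j)" using ij unfolding D'_def by auto
      have sj: "Suc j \<in> {2..k}" using ij by auto
      have pr: "(a, b) \<in> prec" unfolding rel using p b ij sj
        by (intro exI[of _ p] exI[of _ "Suc j"]) auto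
      have "b \<notin> D 2"
      proof
        assume "b \<in> D 2"
        then have "b \<in> C 2" "b \<in> C (Suc j)"
          using array_columns_mem(3)[OF A, of 2 b] array_columns_mem(3)[OF A sj b] k3 by auto
        then show False using array_columns_mem(4)[OF A, of 2 "Suc j" b] sj ij k3 by auto
      qed
      then show "(a, b) \<in> bar P prec" using pr unfolding array_bar_eq[OF A prec] by auto
    qed
    then show ?thesis by (auto simp: set_eq_iff)
  qed
  then show ?thesis using A' unfolding array_taos_data_def by blast
qed

lemma weighted_inner_product:
  fixes w :: "'b \<Rightarrow> real"
  assumes fin: "finite Q" and sub: "B \<subseteq> Q" and pos: "\<forall>b\<in>B. 0 < w b"
  defines "ip \<equiv> (\<lambda>u v. \<Sum>b\<in>Q. w b * u b * v b)"
  shows "inner_product_on {v. \<forall>b. b \<notin> B \<longrightarrow> v b = 0} ip"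
    and "b \<in> B \<Longrightarrow> c \<in> B \<Longrightarrow> ip (basis_vec b) (basis_vec c) = (if b = c then w b else 0)"
proof -
  show "ip (basis_vec b) (basis_vec c) = (if b = c then w b else 0)" if "b \<in> B" "c \<in> B"
  proof -
    have "ip (basis_vec b) (basis_vec c) = (\<Sum>d\<in>Q. if d = b then (if b = c then w b else 0) else 0)"
      unfolding ip_def basis_vec_def by (intro sum.cong) auto
    also have "\<dots> = (if b = c then w b else 0)" using fin sub that by (subst sum.delta) auto
    finally show ?thesis .
  qed
  have "0 < ip v v" if v: "\<forall>b. b \<notin> B \<longrightarrow> v b = 0" and "v \<noteq> (\<lambda>_. 0)" for v
  proof -
    obtain b where b: "v b \<noteq> 0" using \<open>v \<noteq> (\<lambda>_. 0)\<close> by auto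
    then have bB: "b \<in> B" using v by auto
    show ?thesis unfolding ip_def
    proof (rule sum_pos2[OF fin])
      show "b \<in> Q" using bB sub by auto
      have "0 < v b * v b" using b by (metis not_real_square_gt_zero)
      then have "0 < w b * (v b * v b)" using pos bB by (metis mult_pos_pos)
      then show "0 < w b * v b * v b" by (simp add: mult.assoc)
      fix c assume "c \<in> Q"
      show "0 \<le> w c * v c * v c"
      proof (cases "c \<in> B")
        case True
        then have "0 \<le> w c * (v c * v c)" using pos by (intro mult_nonneg_nonneg[of "w c"]) (auto simp: less_imp_le)
        then show ?thesis by (simp add: mult.assoc)
      next
        case False
        then show ?thesis using v by simp
      qed
    qed
  qed
  then show "inner_product_on {v. \<forall>b. b \<notin> B \<longrightarrow> v b = 0} ip"
    unfolding inner_product_on_def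
    by (auto simp: ip_def algebra_simps sum.distrib sum_distrib_left)
qed

theorem array_inner_product_exists:
  assumes "array_taos P prec"
  shows "\<exists>ip. array_inner_product P ip prec"
proof -
  obtain k n m where dat: "array_taos_data P prec k n m" using assms unfolding array_taos_def by auto
  have "2 \<le> k" using dat unfolding array_taos_data_def array_columns_def by auto
  define I :: "('a \<times> 'a \<Rightarrow> real) \<Rightarrow> ('a \<times> 'a \<Rightarrow> real) \<Rightarrow> ('a \<times> 'a \<Rightarrow> real) \<Rightarrow> real"
    where "I w = (\<lambda>u v. \<Sum>b\<in>P \<times> P. w b * u b * v b)" for w
  have sub: "basis_pairs P q \<subseteq> P \<times> P" for q unfolding basis_pairs_def by auto
  from \<open>2 \<le> k\<close> dat have "\<exists>w'. (\<forall>b. 0 < w' b) \<and>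
      (\<forall>w. (\<forall>b\<in>basis_pairs P prec. w b = w' b) \<longrightarrow> array_inner_product P (I w) prec)"
  proof (induction k arbitrary: prec n m rule: dec_induct)
    case base
    have at: "array_taos P prec" using base unfolding array_taos_def by auto
    have fin: "finite (P \<times> P)" using array_taos_imp_taos(2)[OF at] by auto
    have "array_inner_product P (I w) prec" if w: "\<forall>b\<in>basis_pairs P prec. w b = 1" for w
    proof (rule array_inner_product.two)
      show "array_taos P prec" by fact
      show "max_chain_length P prec = 2" using array_max_chain_length[OF base] .
      have pos: "\<forall>b\<in>basis_pairs P prec. 0 < w b" using w by auto
      note W = weighted_inner_product[OF fin sub pos]
      show "inner_product_on (alg_carrier (taos_lie_algebra P prec)) (I w)"
        unfolding I_def taos_lie_algebra_def using W(1) by simp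
      show "\<forall>b\<in>basis_pairs P prec. \<forall>c\<in>basis_pairs P prec.
             I w (basis_vec b) (basis_vec c) = (if b = c then 1 else 0)"
        unfolding I_def using W(2) w by simp
    qed
    then show ?case by (intro exI[of _ "\<lambda>_. 1"]) auto
  next
    case (step k)
    have at: "array_taos P prec" using step.prems unfolding array_taos_def by auto
    have fin: "finite (P \<times> P)" using array_taos_imp_taos(2)[OF at] by auto
    have mpos: "\<forall>i\<in>{1..Suc k}. 1 \<le> m i" using step.prems unfolding array_taos_data_def array_columns_def by auto
    have "real (m 1) \<le> (\<Sum>t = 1..Suc k. real (m t))" by (rule member_le_sum) auto
    moreover have "1 \<le> m 1" using mpos by auto
    ultimately have spos: "0 < 1 / 2 * (\<Sum>t = 1..Suc k. real (m t))" (is "0 < ?s") by simp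
    have "array_taos_data P (bar P prec) k
           (\<lambda>i. if i = 1 then n 1 + n 2 else n (Suc i)) (\<lambda>i. if i = 1 then n 1 + n 2 else m (Suc i))"
      using array_bar_data[OF step.prems] step.hyps by simp
    from step.IH[OF this] obtain w' where w': "\<forall>b. 0 < w' b"
      "\<And>w. (\<forall>b\<in>basis_pairs P (bar P prec). w b = w' b) \<Longrightarrow> array_inner_product P (I w) (bar P prec)"
      by auto
    define v where "v b = (if b \<in> removed_pairs P prec then ?s else w' b)" for b
    have vpos: "0 < v b" for b unfolding v_def using w'(1) spos by (cases b) (simp del: sum.cl_ivl_Suc)
    have "array_inner_product P (I w) prec" if w: "\<forall>b\<in>basis_pairs P prec. w b = v b" for w
    proof (rule array_inner_product.step)
      show "array_taos_data P prec (Suc k) n m" by (rule step.prems)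
      show "max_chain_length P prec = Suc k" using array_max_chain_length[OF step.prems] .
      show "3 \<le> Suc k" using step.hyps by simp
      have pos: "\<forall>b\<in>basis_pairs P prec. 0 < w b" using w vpos by auto
      note W = weighted_inner_product[OF fin sub pos]
      show "inner_product_on (alg_carrier (taos_lie_algebra P prec)) (I w)"
        unfolding I_def taos_lie_algebra_def using W(1) by simp
      show "\<forall>b\<in>basis_pairs P prec. \<forall>c\<in>basis_pairs P prec.
             b \<noteq> c \<longrightarrow> I w (basis_vec b) (basis_vec c) = 0"
        unfolding I_def using W(2) by simp
      show "array_inner_product P (I w) (bar P prec)"
      proof (rule w'(2), intro ballI)
        fix b assume b: "b \<in> basis_pairs P (bar P prec)"
        moreover have "b \<in> basis_pairs P prec" using b unfolding basis_pairs_def bar_def by auto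
        ultimately show "w b = w' b" using w unfolding v_def removed_pairs_def by auto
      qed
      show "\<forall>b\<in>removed_pairs P prec.
             I w (basis_vec b) (basis_vec b) = 1 / 2 * (\<Sum>t = 1..Suc k. real (m t))"
      proof
        fix b assume b: "b \<in> removed_pairs P prec"
        then have "b \<in> basis_pairs P prec" unfolding removed_pairs_def by auto
        then show "I w (basis_vec b) (basis_vec b) = ?s" using W(2)[of b b] w b unfolding v_def I_def by (simp del: sum.cl_ivl_Suc)
      qed
    qed
    then show ?case using vpos by (intro exI[of _ v]) auto
  qed
  then show ?thesis by blast
qed

end

(* Passing from P to bar P merges the first two columns and deletes exactly the pairs leading from
   the first column to a chosen element of the second.  Hence all pairs ending in the same z are
   deleted at the same stage of the recursion, and they receive the same norm there. *)
theory Submission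
  imports Defs
begin

text \<open>An array order is irreflexive and lies in \<open>P \<times> P\<close>, so discarding the
  diagonal changes nothing.\<close>

lemma basis_pairs_array_iff:
  assumes "array_taos P prec" and "q \<subseteq> prec"
  shows "(a, b) \<in> basis_pairs P q \<longleftrightarrow> (a, b) \<in> q"
  using array_taos_imp_taos[OF assms(1)] assms(2)
  unfolding basis_pairs_def taos_def irrefl_def by blast

lemma bar_subset: "bar P prec \<subseteq> prec"
  unfolding bar_def by auto

lemma removed_pairs_array_iff:
  assumes "array_taos P prec"
  shows "(a, b) \<in> removed_pairs P prec \<longleftrightarrow> (a, b) \<in> prec \<and> (a, b) \<notin> bar P prec"
  unfolding removed_pairs_def
  using basis_pairs_array_iff[OF assms order_refl] basis_pairs_array_iff[OF assms bar_subset]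
  by simp

text \<open>The deleted pairs form \<open>C 1 \<times> D 2\<close>, and an element of
  \<open>D 2\<close> has all its predecessors in \<open>C 1\<close>. So the pairs into
  \<open>c\<close> survive or disappear together.\<close>

lemma bar_same_target_imp:
  assumes "array_taos P prec" and "(a, c) \<in> prec" and "(b, c) \<in> prec" and "(a, c) \<in> bar P prec"
  shows "(b, c) \<in> bar P prec"
proof (rule ccontr)
  assume contr: "(b, c) \<notin> bar P prec"
  obtain k n m C D where A: "array_columns P k n m C D" and prec: "prec = (array_base k C D)\<^sup>+"
    using assms(1) unfolding array_taos_def array_taos_data_def by auto
  have k: "2 \<le> k" using A unfolding array_columns_def by auto
  have "c \<in> D 2" using contr assms(3) unfolding array_bar_eq[OF A prec] by auto
  then have "c \<in> C 2" using array_columns_mem(3)[OF A] k by simp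
  obtain i j where ij: "1 \<le> i" "i < j" "j \<le> k" "a \<in> C i" "c \<in> D j"
    using assms(2) unfolding prec array_rel_iff[OF A] by auto
  have "c \<in> C j" using array_columns_mem(3)[OF A, of j c] ij by simp
  \<comment> \<open>Columns are disjoint, so \<open>c\<close> fixes the index \<open>j\<close>; this
    forces \<open>a\<close> into the first column, and \<open>(a, c)\<close> is deleted too.\<close>
  then have "j = 2" using array_columns_mem(4)[OF A, of j 2 c] \<open>c \<in> C 2\<close> ij k by simp
  then have "i = 1" using ij by simp
  then show False
    using assms(4) ij(4) \<open>c \<in> D 2\<close> unfolding array_bar_eq[OF A prec] by simp
qed

text \<open>Induction along the recursion: with two columns all basis vectors have norm 1; later,
  either both pairs survive in \<open>bar P prec\<close> or both are removed.\<close>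

lemma array_inner_product_same_target:
  assumes "array_inner_product P ip prec" and "(a, c) \<in> prec" and "(b, c) \<in> prec"
  shows "ip (basis_vec (a, c)) (basis_vec (a, c)) = ip (basis_vec (b, c)) (basis_vec (b, c))"
  using assms
proof (induction rule: array_inner_product.induct)
  case (two prec)
  then show ?case using basis_pairs_array_iff[OF two.hyps(1) order_refl] by simp
next
  case (step prec r n m)
  have arr: "array_taos P prec" using step.hyps(1) unfolding array_taos_def by blast
  show ?case
  proof (cases "(a, c) \<in> bar P prec")
    case True
    then show ?thesis using step.IH bar_same_target_imp[OF arr step.prems] by blast
  next
    case False
    \<comment> \<open>Contrapositive of the implication with \<open>a\<close> and \<open>b\<close>
      exchanged.\<close>
    then have "(b, c) \<notin> bar P prec"
      using bar_same_target_imp[OF arr step.prems(2,1)] by blast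
    then have "(a, c) \<in> removed_pairs P prec" "(b, c) \<in> removed_pairs P prec"
      using False step.prems by (simp_all add: removed_pairs_array_iff[OF arr])
    \<comment> \<open>The value prescribed on removed pairs, half the sum of the \<open>m t\<close>,
      does not depend on the pair.\<close>
    then show ?thesis using step.hyps by metis
  qed
qed

theorem proposition4p13:
  fixes P :: "'a set" and prec :: "'a rel"
    and ip :: "('a \<times> 'a \<Rightarrow> real) \<Rightarrow> ('a \<times> 'a \<Rightarrow> real) \<Rightarrow> real"
    and x y z :: 'a
  assumes "finite P"
    and "array_taos P prec"
    and "array_inner_product P ip prec"
    and "x \<in> P" and "y \<in> P" and "z \<in> P"
    and "(x, y) \<in> prec" and "(y, z) \<in> prec"
    and "\<not> (\<exists>t\<in>P. (y, t) \<in> prec \<and> (t, z) \<in> prec)"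
  shows "ip_norm ip (basis_vec (x, z)) = ip_norm ip (basis_vec (y, z))"
proof -
  have "(x, z) \<in> prec"
    using array_taos_imp_taos(1)[OF assms(2)] assms(7,8) unfolding taos_def by (meson transD)
  then show ?thesis
    unfolding ip_norm_def using array_inner_product_same_target[OF assms(3) _ assms(8)] by simp
qed

end
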